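(* Let $q\in\mathbb{R}$. The equation $x^3+x+q=0$ has a unique real solution $r$, and there exists a positive real number $s$ such that $$r=\left(-\frac q2+s\right)^{1/3}+\left(-\frac q2-s\right)^{1/3}.$$ Moreover, $s$ can be expressed explicitly as $s=\sqrt{\frac{q^2}{4}+\frac1{27}}$.
   Context: For a real number $t$, $t^{1/3}$ denotes its real cube root (negative if $t<0$). *)

theory Defs
  imports Complex_Main
begin

end

theory Submission
  imports Defs
begin

text \<open>Cardano's method: the two radicands are the roots of z^2 + q z - 1/27, so their cube
  roots u, v satisfy u^3 + v^3 = -q and u v = -1/3. Expanding (u + v)^3 then shows that u + v solves
  the cubic (\<open>cardano_root\<close>). As the cubic has at most one real root
  (\<open>depressed_cubic_root_unique\<close>), every root has this form.\<close>

lemma depressed_cubic_root_unique: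
  fixes x y q :: real
  assumes "x ^ 3 + x + q = 0" and "y ^ 3 + y + q = 0"
  shows "x = y"
proof -
  have "(x - y) * (x\<^sup>2 + x * y + y\<^sup>2 + 1) = (x ^ 3 + x + q) - (y ^ 3 + y + q)"
    by (simp add: algebra_simps power2_eq_square power3_eq_cube)
  then have "(x - y) * (x\<^sup>2 + x * y + y\<^sup>2 + 1) = 0"
    using assms by simp
  \<comment> \<open>Completing the square shows that the cofactor of \<open>x - y\<close> is
    positive, so \<open>x - y\<close> must vanish.\<close>
  moreover have "x\<^sup>2 + x * y + y\<^sup>2 + 1 = (x + y / 2)\<^sup>2 + 3 / 4 * y\<^sup>2 + 1"
    by (simp add: algebra_simps power2_eq_square)
  moreover have "(x + y / 2)\<^sup>2 + 3 / 4 * y\<^sup>2 + 1 > 0"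
    by (simp add: add_nonneg_pos)
  ultimately show ?thesis
    by simp
qed

lemma cardano_root:
  fixes q :: real
  defines "s \<equiv> sqrt (q\<^sup>2 / 4 + 1 / 27)"
  defines "r \<equiv> root 3 (- (q / 2) + s) + root 3 (- (q / 2) - s)"
  shows "r ^ 3 + r + q = 0"
proof -
  define u v where "u = root 3 (- (q / 2) + s)" and "v = root 3 (- (q / 2) - s)"
  have cubes: "u ^ 3 = - (q / 2) + s" "v ^ 3 = - (q / 2) - s"
    by (simp_all add: u_def v_def odd_real_root_pow)
  have "s\<^sup>2 = q\<^sup>2 / 4 + 1 / 27"
    by (simp add: s_def)
  \<comment> \<open>The term 1/27 in \<open>s\<close> makes this product the cube of -1/3. The real
    cube root undoes the cube even for this negative base.\<close>
  then have "(- (q / 2) + s) * (- (q / 2) - s) = (- (1 / 3)) ^ 3"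
    by (simp add: algebra_simps power2_eq_square power3_eq_cube)
  then have "u * v = root 3 ((- (1 / 3)) ^ 3)"
    by (simp add: u_def v_def flip: real_root_mult)
  then have uv: "u * v = - (1 / 3)"
    by (subst (asm) odd_real_root_power_cancel) simp_all
  have "(u + v) ^ 3 = u ^ 3 + v ^ 3 + 3 * (u * v) * (u + v)"
    by (simp add: algebra_simps power3_eq_cube)
  \<comment> \<open>In the sum of cubes \<open>s\<close> cancels; \<open>u * v = - (1 / 3)\<close>
    turns the mixed term into the linear term of the cubic.\<close>
  also have "\<dots> = - q - (u + v)"
    by (simp add: cubes uv)
  finally show ?thesis
    by (simp add: r_def u_def v_def)
qed

theorem theorem4:
  fixes q :: real
  shows "(\<exists>!r::real. r ^ 3 + r + q = 0) \<and>
    (\<forall>r::real. r ^ 3 + r + q = 0 \<longrightarrow>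
      (\<exists>s::real. s > 0 \<and>
        r = root 3 (- (q / 2) + s) + root 3 (- (q / 2) - s) \<and>
        s = sqrt (q\<^sup>2 / 4 + 1 / 27)))"
proof -
  have "sqrt (q\<^sup>2 / 4 + 1 / 27) > 0"
    by (simp add: add_nonneg_pos)
  then show ?thesis
    using cardano_root[of q] depressed_cubic_root_unique[of _ q] by blast
qed

end
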